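(* Let $X$ be a compact metric space, $T:X\to X$ a continuous map of finite topological entropy and $U\subset C(X)$ an open set. The set of points at which the pressure $P:U\to\mathbb{R}$ is not Gateaux differentiable is Aronszajn null.
   Context: $C(X)$ is the Banach space of real continuous functions on $X$ with the supremum norm. A set $E\subset X$ is $(n,\epsilon)$-separated if for all distinct $x,y\in E$ there is $j\in\{0,\ldots,n-1\}$ with $d(T^jx,T^jy)>\epsilon$. Put $Q_n(T,\phi,\epsilon)=\sup\{\sum_{x\in E}e^{\sum_{i=0}^{n-1}\phi(T^ix)}: E\subset X \text{ is }(n,\epsilon)\text{-separated}\}$ and $P(\phi)=\lim_{\epsilon\to0}\limsup_{n\to\infty}\frac1n\log Q_n(T,\phi,\epsilon)$ for $\phi\in C(X)$ (the pressure). The topological entropy is $h_{top}(T)=P(0)$. $P$ is Gateaux differentiable at $\phi$ if for every $\psi\in C(X)$ the limit $\lim_{t\to0}\frac{P(\phi+t\psi)-P(\phi)}{t}$ exists. Aronszajn null: let $B$ be a separable Banach space. For $0\ne a\in B$ let $\mathcal{A}(a)$ be the family of Borel sets $A\subset B$ with $\mathrm{Leb}(\{t\in\mathbb{R}: x+ta\in A\})=0$ for every $x\in B$. For a sequence $(a_n)_n$ of nonzero elements, $\mathcal{A}((a_n))$ is the collection of Borel sets $A=\bigcup_n A_n$ with $A_n\in\mathcal{A}(a_n)$. A Borel set is Aronszajn null if it belongs to $\mathcal{A}((a_n))$ for every sequence $(a_n)_n$ of nonzero elements whose linear span is dense in $B$. *)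

theory Defs
  imports "HOL-Analysis.Analysis"
begin

text \<open>
  The phase space is a whole type, assumed compact where needed. For compact \<open>X\<close> every
  continuous real function is bounded, so the type \<open>'a \<Rightarrow>\<^sub>C real\<close> with its supremum norm
  is \<open>C(X)\<close>.
\<close>

instance bcontfun :: (metric_space, banach) banach ..

definition separated :: "('a::metric_space \<Rightarrow> 'a) \<Rightarrow> nat \<Rightarrow> real \<Rightarrow> 'a set \<Rightarrow> bool" where
  "separated T n \<epsilon> E \<longleftrightarrow>
     (\<forall>x\<in>E. \<forall>y\<in>E. x \<noteq> y \<longrightarrow> (\<exists>j<n. dist ((T ^^ j) x) ((T ^^ j) y) > \<epsilon>))"

text \<open>
  For continuous \<open>T\<close> on a compact space and \<open>\<epsilon> > 0\<close>, the cardinalities of the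
  \<open>(n, \<epsilon>)\<close>-separated sets are finite and uniformly bounded. Hence the sums below are
  finite sums, and the supremum is that of a nonempty, bounded set of reals; it is positive
  because singletons are separated.
\<close>

definition sep_sum_sup ::
    "('a::metric_space \<Rightarrow> 'a) \<Rightarrow> ('a \<Rightarrow>\<^sub>C real) \<Rightarrow> real \<Rightarrow> nat \<Rightarrow> real" where
  "sep_sum_sup T \<phi> \<epsilon> n =
     Sup {\<Sum>x\<in>E. exp (\<Sum>i<n. apply_bcontfun \<phi> ((T ^^ i) x)) | E. separated T n \<epsilon> E}"

text \<open>
  The limit in \<open>\<epsilon>\<close> exists in the extended reals, since the upper limit is
  nonincreasing in \<open>\<epsilon>\<close>.
\<close>

definition pressure :: "('a::metric_space \<Rightarrow> 'a) \<Rightarrow> ('a \<Rightarrow>\<^sub>C real) \<Rightarrow> ereal" where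
  "pressure T \<phi> =
     Lim (at_right (0::real))
       (\<lambda>\<epsilon>. limsup (\<lambda>n. ereal (1 / real n * ln (sep_sum_sup T \<phi> \<epsilon> n))))"

definition top_entropy :: "('a::metric_space \<Rightarrow> 'a) \<Rightarrow> ereal" where
  "top_entropy T = pressure T 0"

definition gateaux_differentiable_at ::
    "('b::real_normed_vector \<Rightarrow> real) \<Rightarrow> 'b \<Rightarrow> bool" where
  "gateaux_differentiable_at F \<phi> \<longleftrightarrow>
     (\<forall>\<psi>. \<exists>L. ((\<lambda>t::real. (F (\<phi> + t *\<^sub>R \<psi>) - F \<phi>) / t) \<longlongrightarrow> L) (at 0))"

definition line_null :: "'b::banach \<Rightarrow> 'b set set" where
  "line_null a =
     {A \<in> sets borel. \<forall>x. {t::real. x + t *\<^sub>R a \<in> A} \<in> null_sets lborel}"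

definition seq_line_null :: "(nat \<Rightarrow> 'b::banach) \<Rightarrow> 'b set set" where
  "seq_line_null a =
     {A \<in> sets borel. \<exists>S. (\<forall>n. S n \<in> line_null (a n)) \<and> A = (\<Union>n. S n)}"

text \<open>
  The notion is meant for separable spaces, where sequences with dense span exist. Separability
  is not a class constraint because \<open>'a \<Rightarrow>\<^sub>C real\<close> is separable only for suitable
  \<open>'a\<close>, among them the compact metric spaces.
\<close>

definition aronszajn_null :: "'b::banach set \<Rightarrow> bool" where
  "aronszajn_null A \<longleftrightarrow> A \<in> sets borel \<and>
     (\<forall>a::nat \<Rightarrow> 'b. (\<forall>n. a n \<noteq> 0) \<and> closure (span (range a)) = UNIV
        \<longrightarrow> A \<in> seq_line_null a)"

end

theory Submission
  imports Defs
begin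

text \<open>
  The result is a statement about convex functions: a convex Lipschitz function \<open>F\<close> on a separable
  Banach space fails to be Gateaux differentiable only on an Aronszajn null set. Finiteness of the
  entropy makes the pressure a real-valued function, and it is convex (by Hoelder's inequality for
  the sums over separated sets) and \<open>1\<close>-Lipschitz (changing \<open>\<phi>\<close> by \<open>\<delta>\<close> in norm changes the orbit
  sums of length \<open>n\<close> by at most \<open>n \<delta>\<close>): lemmas \<open>convex_pressure\<close> and \<open>lipschitz_pressure\<close>.

  For convex \<open>F\<close>, differentiability at \<open>x\<close> in the direction \<open>a\<close> means that the symmetric second
  difference \<open>F (x + t a) + F (x - t a) - 2 F x\<close> is \<open>o(t)\<close> as \<open>t\<close> decreases to \<open>0\<close>. Three facts follow.

    \<^item> At a fixed point the directions of differentiability form a closed subspace. Hence Gateaux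
      differentiability at \<open>x\<close> need only be tested on the directions \<open>a\<^sub>n\<close> of a sequence with dense
      span, and the exceptional set is the union over \<open>n\<close> of the sets \<open>A\<^sub>n\<close> where differentiability in
      the direction \<open>a\<^sub>n\<close> fails (\<open>gateaux_differentiable_iff_smooth_on\<close>).
    \<^item> On each line parallel to \<open>a\<^sub>n\<close> the set \<open>A\<^sub>n\<close> is countable, because it consists of jumps of the
      monotone one-sided derivatives of a convex function of one variable (\<open>countable_nonsmooth_on_line\<close>).
    \<^item> Each \<open>A\<^sub>n\<close> is a countable union of closed sets, hence Borel (\<open>borel_nonsmooth\<close>).

  An Aronszajn null set is in particular Borel. This part of the claim calls for one countable set
  of directions with dense span to exist, that is, for the separability of \<open>C(X)\<close>
  (\<open>countable_dense_span_bcontfun\<close>).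
\<close>

section \<open>Directional differentiability of convex functions\<close>

definition second_diff :: "('b::real_normed_vector \<Rightarrow> real) \<Rightarrow> 'b \<Rightarrow> 'b \<Rightarrow> real \<Rightarrow> real" where
  "second_diff F x a t = F (x + t *\<^sub>R a) + F (x - t *\<^sub>R a) - 2 * F x"

text \<open>
  For convex \<open>F\<close> this says that the one-sided derivatives of \<open>F\<close> in the direction \<open>a\<close> agree.
  Unlike the existence of a limit, it mentions neither the derivative nor a neighbourhood of \<open>0\<close>:
  one \<open>t\<close> suffices for each \<open>e\<close>. It therefore exhibits the points of smoothness as a countable
  intersection of open sets, and it passes easily to sums and limits of directions.
\<close>

definition smooth_in_dir :: "('b::real_normed_vector \<Rightarrow> real) \<Rightarrow> 'b \<Rightarrow> 'b \<Rightarrow> bool" where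
  "smooth_in_dir F x a \<longleftrightarrow> (\<forall>e>0. \<exists>t>0. second_diff F x a t < e * t)"

lemma convex_chord_along_line:
  fixes F :: "'b::real_normed_vector \<Rightarrow> real"
  assumes "convex_on UNIV F" and "r < s" "s < t"
  shows "(t - r) * F (x + s *\<^sub>R a) \<le> (t - s) * F (x + r *\<^sub>R a) + (s - r) * F (x + t *\<^sub>R a)"
proof -
  define u where "u = (s - r) / (t - r)"
  have u: "0 \<le> u" "u \<le> 1" and u1: "(t - r) * u = s - r" "(t - r) * (1 - u) = t - s"
    using assms by (auto simp: u_def field_simps)
  have su: "s = (1 - u) * r + u * t"
    using u1(1) by (simp add: algebra_simps)
  have "x + s *\<^sub>R a = (1 - u) *\<^sub>R (x + r *\<^sub>R a) + u *\<^sub>R (x + t *\<^sub>R a)"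
    unfolding su by (simp add: algebra_simps)
  then have "F (x + s *\<^sub>R a) \<le> (1 - u) * F (x + r *\<^sub>R a) + u * F (x + t *\<^sub>R a)"
    using convex_onD[OF assms(1) u] by simp
  then have "(t - r) * F (x + s *\<^sub>R a)
      \<le> (t - r) * ((1 - u) * F (x + r *\<^sub>R a) + u * F (x + t *\<^sub>R a))"
    using assms by (intro mult_left_mono) auto
  also have "\<dots> = (t - s) * F (x + r *\<^sub>R a) + (s - r) * F (x + t *\<^sub>R a)"
    using u1 by (simp add: distrib_left flip: mult.assoc)
  finally show ?thesis .
qed

lemma second_diff_nonneg:
  assumes "convex_on UNIV F" and "0 < t"
  shows "0 \<le> second_diff F x a t"
proof -
  have "t * (2 * F x) \<le> t * (F (x - t *\<^sub>R a) + F (x + t *\<^sub>R a))"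
    using convex_chord_along_line[OF assms(1), of "-t" 0 t x a] assms
    by (simp add: algebra_simps)
  then have "2 * F x \<le> F (x - t *\<^sub>R a) + F (x + t *\<^sub>R a)"
    using assms by (subst (asm) mult_le_cancel_left_pos) auto
  then show ?thesis
    by (simp add: second_diff_def)
qed

text \<open>Slopes of a convex function increase, hence so do the quotients \<open>second_diff F x a t / t\<close>.\<close>

lemma second_diff_mono:
  assumes F: "convex_on UNIV F" and st: "0 < s" "s \<le> t"
    and less: "second_diff F x a t < e * t"
  shows "second_diff F x a s < e * s"
proof (cases "s = t")
  case False
  then have "s < t" using st by simp
  have 1: "t * F (x + s *\<^sub>R a) \<le> (t - s) * F x + s * F (x + t *\<^sub>R a)"
    using convex_chord_along_line[OF F, of 0 s t x a] st \<open>s < t\<close> by simp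
  have 2: "t * F (x - s *\<^sub>R a) \<le> (t - s) * F x + s * F (x - t *\<^sub>R a)"
    using convex_chord_along_line[OF F, of 0 s t x "-a"] st \<open>s < t\<close> by simp
  have "t * second_diff F x a s \<le> s * second_diff F x a t"
    using 1 2 by (simp add: second_diff_def algebra_simps)
  also have "\<dots> < s * (e * t)"
    using less st by simp
  finally have "t * second_diff F x a s < t * (e * s)"
    by (simp add: mult_ac)
  then show ?thesis
    using st by simp
qed (use less in simp)

text \<open>
  The slopes to the left of \<open>x\<close> lie below the slopes to the right, so the infimum of the latter
  separates the two families.
\<close>

lemma convex_subgradient_along_line:
  fixes F :: "'b::real_normed_vector \<Rightarrow> real"
  assumes F: "convex_on UNIV F"
  obtains R where "\<And>s. F x + s * R \<le> F (x + s *\<^sub>R a)"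
proof -
  define q where "q t = (F (x + t *\<^sub>R a) - F x) / t" for t
  have left_le_right: "(F x - F (x - s *\<^sub>R a)) / s \<le> q t" if "s > 0" "t > 0" for s t
    using convex_chord_along_line[OF F, of "-s" 0 t x a] that
    by (simp add: q_def field_simps)
  define R where "R = Inf (q ` {0<..})"
  have "bdd_below (q ` {0<..})"
    using left_le_right[OF zero_less_one] by (intro bdd_belowI2) auto
  then have R1: "R \<le> q t" if "t > 0" for t
    unfolding R_def using that by (intro cInf_lower) auto
  have R2: "(F x - F (x - s *\<^sub>R a)) / s \<le> R" if "s > 0" for s
    unfolding R_def using that left_le_right by (intro cInf_greatest) auto
  have "F x + s * R \<le> F (x + s *\<^sub>R a)" for s
  proof -
    consider "s > 0" | "s = 0" | "s < 0" by linarith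
    then show ?thesis
    proof cases
      case 1 with R1[of s] show ?thesis by (simp add: q_def field_simps)
    next
      case 3 with R2[of "-s"] show ?thesis by (simp add: field_simps)
    qed simp
  qed
  then show ?thesis by (rule that)
qed

text \<open>
  With \<open>R\<close> a subgradient along the line, the error \<open>(F (x + t *\<^sub>R a) - F x) / t - R\<close> is bounded by
  the second difference divided by \<open>\<bar>t\<bar>\<close>, because the errors at \<open>t\<close> and \<open>-t\<close> have opposite signs.
\<close>

lemma differentiable_in_dir_iff_smooth:
  fixes F :: "'b::real_normed_vector \<Rightarrow> real"
  assumes F: "convex_on UNIV F"
  shows "(\<exists>L. ((\<lambda>t::real. (F (x + t *\<^sub>R a) - F x) / t) \<longlongrightarrow> L) (at 0)) \<longleftrightarrow> smooth_in_dir F x a"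
    (is "(\<exists>L. (?q \<longlongrightarrow> L) (at 0)) \<longleftrightarrow> _")
proof
  assume "\<exists>L. (?q \<longlongrightarrow> L) (at 0)"
  then obtain L where L: "(?q \<longlongrightarrow> L) (at 0)" by blast
  show "smooth_in_dir F x a"
    unfolding smooth_in_dir_def
  proof (intro allI impI)
    fix e :: real assume "e > 0"
    then have "\<forall>\<^sub>F t in at 0. dist (?q t) L < e / 2"
      using L by (intro tendstoD) auto
    then obtain d where d: "d > 0" "\<And>t. t \<noteq> 0 \<Longrightarrow> dist t 0 < d \<Longrightarrow> dist (?q t) L < e / 2"
      unfolding eventually_at by auto
    define t where "t = d / 2"
    have t: "t > 0" using d by (simp add: t_def)
    have "dist (?q t) L < e / 2" "dist (?q (-t)) L < e / 2"
      using d(1) by (intro d(2); simp add: t_def)+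
    then have "?q t - ?q (-t) < e"
      unfolding dist_real_def by linarith
    then have "second_diff F x a t / t < e"
      by (simp add: second_diff_def diff_divide_distrib add_divide_distrib)
    then show "\<exists>t>0. second_diff F x a t < e * t"
      using t by (auto simp: field_simps)
  qed
next
  assume smooth: "smooth_in_dir F x a"
  obtain R where R: "\<And>s. F x + s * R \<le> F (x + s *\<^sub>R a)"
    using convex_subgradient_along_line[OF F] by blast
  have "(?q \<longlongrightarrow> R) (at 0)"
  proof (rule tendstoI)
    fix e :: real assume "e > 0"
    then obtain d where d: "d > 0" "second_diff F x a d < e * d"
      using smooth unfolding smooth_in_dir_def by blast
    have "dist (?q t) R < e" if "t \<noteq> 0" "dist t 0 < d" for t
    proof -
      have "second_diff F x a \<bar>t\<bar> < e * \<bar>t\<bar>"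
        using that d by (intro second_diff_mono[OF F _ _ d(2)]) auto
      then have sd: "F (x + t *\<^sub>R a) + F (x - t *\<^sub>R a) - 2 * F x < e * \<bar>t\<bar>"
        by (cases "t > 0") (auto simp: second_diff_def)
      have "?q t - R = (F (x + t *\<^sub>R a) - F x - t * R) / t"
        using that by (simp add: field_simps)
      then have "dist (?q t) R = \<bar>F (x + t *\<^sub>R a) - F x - t * R\<bar> / \<bar>t\<bar>"
        by (simp add: dist_real_def)
      also have "\<bar>F (x + t *\<^sub>R a) - F x - t * R\<bar> < e * \<bar>t\<bar>"
        using sd R[of t] R[of "-t"] by simp
      finally show ?thesis
        using that by (simp add: divide_less_eq divide_strict_right_mono)
    qed
    then show "\<forall>\<^sub>F t in at 0. dist (?q t) R < e"
      using d unfolding eventually_at by blast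
  qed
  then show "\<exists>L. (?q \<longlongrightarrow> L) (at 0)" by blast
qed

corollary gateaux_differentiable_iff_smooth:
  assumes "convex_on UNIV F"
  shows "gateaux_differentiable_at F x \<longleftrightarrow> (\<forall>a. smooth_in_dir F x a)"
  unfolding gateaux_differentiable_at_def differentiable_in_dir_iff_smooth[OF assms] ..

section \<open>The directions of smoothness at a point\<close>

lemma smooth_in_dir_add:
  assumes F: "convex_on UNIV F" and a: "smooth_in_dir F x a" and b: "smooth_in_dir F x b"
  shows "smooth_in_dir F x (a + b)"
  unfolding smooth_in_dir_def
proof (intro allI impI)
  fix e :: real assume "e > 0"
  then have "e / 2 > 0" by simp
  obtain s where s: "s > 0" "second_diff F x a s < e / 2 * s"
    using a \<open>e / 2 > 0\<close> unfolding smooth_in_dir_def by blast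
  obtain t where t: "t > 0" "second_diff F x b t < e / 2 * t"
    using b \<open>e / 2 > 0\<close> unfolding smooth_in_dir_def by blast
  define u where "u = min s t / 2"
  have u: "u > 0" "2 * u \<le> s" "2 * u \<le> t"
    using s t by (auto simp: u_def)
  have gap: "second_diff F x a (2 * u) < e / 2 * (2 * u)" "second_diff F x b (2 * u) < e / 2 * (2 * u)"
    using u by (intro second_diff_mono[OF F _ _ s(2)] second_diff_mono[OF F _ _ t(2)]; simp)+
  \<comment> \<open>\<open>x \<plusminus> u(a + b)\<close> is the midpoint of \<open>x \<plusminus> 2ua\<close> and \<open>x \<plusminus> 2ub\<close>.\<close>
  have mid: "F (x + u *\<^sub>R (c + d)) \<le> (F (x + (2 * u) *\<^sub>R c) + F (x + (2 * u) *\<^sub>R d)) / 2" for c d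
  proof -
    have "x + u *\<^sub>R (c + d) = (1 - 1/2) *\<^sub>R (x + (2 * u) *\<^sub>R c) + (1/2) *\<^sub>R (x + (2 * u) *\<^sub>R d)"
      by (simp add: algebra_simps flip: scaleR_add_left)
    then show ?thesis
      using convex_onD[OF F, of "1/2" "x + (2 * u) *\<^sub>R c" "x + (2 * u) *\<^sub>R d"] by simp
  qed
  have "second_diff F x (a + b) u < e * u"
    using mid[of a b] mid[of "-a" "-b"] gap unfolding second_diff_def
    by (simp add: algebra_simps)
  then show "\<exists>t>0. second_diff F x (a + b) t < e * t"
    using u by blast
qed

lemma smooth_in_dir_scaleR:
  assumes a: "smooth_in_dir F x a"
  shows "smooth_in_dir F x (c *\<^sub>R a)"
proof (cases "c = 0")
  case True
  then show ?thesis
    unfolding smooth_in_dir_def second_diff_def by (auto intro: exI[of _ 1])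
next
  case False
  show ?thesis
    unfolding smooth_in_dir_def
  proof (intro allI impI)
    fix e :: real assume "e > 0"
    then obtain s where s: "s > 0" "second_diff F x a s < e / \<bar>c\<bar> * s"
      using a False unfolding smooth_in_dir_def by (meson divide_pos_pos zero_less_abs_iff)
    have "second_diff F x (c *\<^sub>R a) (s / \<bar>c\<bar>) = second_diff F x a s"
      using False by (cases "c > 0") (simp_all add: second_diff_def)
    then show "\<exists>t>0. second_diff F x (c *\<^sub>R a) t < e * t"
      using s False by (intro exI[of _ "s / \<bar>c\<bar>"]) auto
  qed
qed

text \<open>
  Replacing \<open>a\<close> by \<open>b\<close> changes the second difference at \<open>t\<close> by at most \<open>2 * K * t * dist a b\<close>, which
  is linear in \<open>t\<close> like the bound to be proved.
\<close>

lemma smooth_in_dir_closure: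
  assumes K: "K-lipschitz_on UNIV F"
    and a: "a \<in> closure {b. smooth_in_dir F x b}"
  shows "smooth_in_dir F x a"
  unfolding smooth_in_dir_def
proof (intro allI impI)
  fix e :: real assume "e > 0"
  have "K \<ge> 0" using K by (rule lipschitz_on_nonneg)
  \<comment> \<open>\<open>d\<close> makes \<open>2 * K * d \<le> e / 2\<close>; the summand \<open>1\<close> covers \<open>K = 0\<close>.\<close>
  define d where "d = e / (2 * (2 * K + 1))"
  have "d > 0" using \<open>e > 0\<close> \<open>K \<ge> 0\<close> by (simp add: d_def)
  then obtain b where b: "smooth_in_dir F x b" "dist b a < d"
    using a unfolding closure_approachable by blast
  have "e / 2 > 0" using \<open>e > 0\<close> by simp
  then obtain t where t: "t > 0" "second_diff F x b t < e / 2 * t"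
    using b(1) unfolding smooth_in_dir_def by blast
  have "dist (x + t *\<^sub>R a) (x + t *\<^sub>R b) = t * dist b a"
       "dist (x - t *\<^sub>R a) (x - t *\<^sub>R b) = t * dist b a"
    using t by (simp_all add: dist_norm norm_minus_commute flip: scaleR_diff_right)
  then have "\<bar>F (x + t *\<^sub>R a) - F (x + t *\<^sub>R b)\<bar> \<le> K * (t * dist b a)"
            "\<bar>F (x - t *\<^sub>R a) - F (x - t *\<^sub>R b)\<bar> \<le> K * (t * dist b a)"
    using lipschitz_onD[OF K] by (metis UNIV_I dist_real_def)+
  then have "second_diff F x a t \<le> second_diff F x b t + 2 * K * dist b a * t"
    unfolding second_diff_def by (simp add: algebra_simps abs_le_iff)
  also have "2 * K * dist b a * t \<le> e / 2 * t"
  proof -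
    have "2 * K * dist b a \<le> (2 * K + 1) * d"
      using b(2) \<open>K \<ge> 0\<close> by (intro mult_mono) auto
    also have "\<dots> = e / 2"
      using \<open>K \<ge> 0\<close> by (simp add: d_def field_simps)
    finally show ?thesis
      using t by (intro mult_right_mono) auto
  qed
  finally show "\<exists>t>0. second_diff F x a t < e * t"
    using t by (intro exI[of _ t]) auto
qed

text \<open>
  The directions of smoothness form a closed subspace, so a set with dense span suffices as a set
  of test directions.
\<close>

lemma gateaux_differentiable_iff_smooth_on:
  assumes F: "convex_on UNIV F" and K: "K-lipschitz_on UNIV F"
    and dense: "closure (span C) = UNIV"
  shows "gateaux_differentiable_at F x \<longleftrightarrow> (\<forall>a\<in>C. smooth_in_dir F x a)"
proof
  assume C: "\<forall>a\<in>C. smooth_in_dir F x a"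
  have "subspace {a. smooth_in_dir F x a}"
    using smooth_in_dir_add[OF F] smooth_in_dir_scaleR[of F x] C
    by (auto simp: subspace_def smooth_in_dir_def second_diff_def intro: exI[of _ 1])
  then have "span C \<subseteq> {a. smooth_in_dir F x a}"
    using C by (intro span_minimal) auto
  then have "closure {a. smooth_in_dir F x a} = UNIV"
    using closure_mono dense by blast
  then show "gateaux_differentiable_at F x"
    unfolding gateaux_differentiable_iff_smooth[OF F]
    using smooth_in_dir_closure[OF K] by blast
qed (use gateaux_differentiable_iff_smooth[OF F] in blast)

section \<open>Nullity of the non-smooth points in one direction\<close>

text \<open>
  A selection \<open>R\<close> of subgradients of a convex function on the line is monotone, hence continuous
  off a countable set, and a point of continuity of \<open>R\<close> is a point of smoothness.
\<close>

lemma countable_nonsmooth_real: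
  fixes f :: "real \<Rightarrow> real"
  assumes f: "convex_on UNIV f"
  shows "countable {x. \<not> smooth_in_dir f x 1}"
proof -
  have "\<forall>x. \<exists>R. \<forall>s. f x + s * R \<le> f (x + s *\<^sub>R 1)"
    using convex_subgradient_along_line[OF f, of _ 1] by metis
  then obtain R where R: "f x + s * R x \<le> f (x + s)" for x s
    unfolding real_scaleR_def mult_1_right by metis
  have "mono R"
  proof (rule monoI)
    fix x y :: real assume "x \<le> y"
    have "(y - x) * R x \<le> (y - x) * R y"
      using R[of x "y - x"] R[of y "x - y"] by (simp add: algebra_simps)
    then show "R x \<le> R y"
      using \<open>x \<le> y\<close> by (cases "x = y") auto
  qed
  have "smooth_in_dir f x 1" if cont: "isCont R x" for x
    unfolding smooth_in_dir_def
  proof (intro allI impI)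
    fix e :: real assume "e > 0"
    then obtain d where d: "d > 0" "\<And>y. dist y x < d \<Longrightarrow> dist (R y) (R x) < e / 2"
      using cont unfolding continuous_at_eps_delta by (metis half_gt_zero)
    define t where "t = d / 2"
    have t: "t > 0" using d by (simp add: t_def)
    have "dist (R (x + t)) (R x) < e / 2" "dist (R (x - t)) (R x) < e / 2"
      using d by (auto intro!: d(2) simp: t_def dist_real_def)
    then have "R (x + t) - R (x - t) < e"
      unfolding dist_real_def by linarith
    then have "t * (R (x + t) - R (x - t)) < t * e"
      using t by simp
    moreover have "second_diff f x 1 t \<le> t * (R (x + t) - R (x - t))"
      using R[of "x + t" "-t"] R[of "x - t" t] by (simp add: second_diff_def algebra_simps)
    ultimately have "second_diff f x 1 t < e * t"
      unfolding mult.commute[of e] by linarith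
    then show "\<exists>t>0. second_diff f x 1 t < e * t"
      using t by blast
  qed
  then have "{x. \<not> smooth_in_dir f x 1} \<subseteq> {x. \<not> isCont R x}"
    by blast
  then show ?thesis
    using mono_ctble_discont[OF \<open>mono R\<close>] countable_subset by blast
qed

lemma countable_nonsmooth_on_line:
  fixes F :: "'b::real_normed_vector \<Rightarrow> real"
  assumes F: "convex_on UNIV F"
  shows "countable {t::real. \<not> smooth_in_dir F (x + t *\<^sub>R a) a}"
proof -
  define f where "f t = F (x + t *\<^sub>R a)" for t :: real
  have "convex_on UNIV f"
  proof (rule convex_onI)
    fix u r s :: real assume "0 < u" "u < 1"
    have "x + ((1 - u) *\<^sub>R r + u *\<^sub>R s) *\<^sub>R a = (1 - u) *\<^sub>R (x + r *\<^sub>R a) + u *\<^sub>R (x + s *\<^sub>R a)"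
      by (simp add: algebra_simps)
    then show "f ((1 - u) *\<^sub>R r + u *\<^sub>R s) \<le> (1 - u) * f r + u * f s"
      using convex_onD[OF F, of u "x + r *\<^sub>R a" "x + s *\<^sub>R a"] \<open>0 < u\<close> \<open>u < 1\<close>
      by (simp add: f_def)
  qed simp
  moreover have "second_diff f t 1 s = second_diff F (x + t *\<^sub>R a) a s" for t s
    by (simp add: second_diff_def f_def algebra_simps)
  then have "smooth_in_dir f t 1 \<longleftrightarrow> smooth_in_dir F (x + t *\<^sub>R a) a" for t
    by (simp add: smooth_in_dir_def)
  ultimately show ?thesis
    using countable_nonsmooth_real[of f] by simp
qed

text \<open>The union over all real \<open>t > 0\<close> is harmless, since it is a union of open sets.\<close>

lemma borel_nonsmooth:
  fixes F :: "'b::real_normed_vector \<Rightarrow> real"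
  assumes F: "continuous_on UNIV F"
  shows "{x. \<not> smooth_in_dir F x a} \<in> sets borel"
proof -
  have open_lt: "open {x. second_diff F x a t < c}" for t c
    unfolding second_diff_def
    by (intro open_Collect_less continuous_intros continuous_on_compose2[OF F]) auto
  define G where "G k = (\<Union>t\<in>{0<..}. {x. second_diff F x a t < 1 / real (Suc k) * t})" for k
  have "smooth_in_dir F x a \<longleftrightarrow> (\<forall>k. x \<in> G k)" for x
  proof
    assume "\<forall>k. x \<in> G k"
    show "smooth_in_dir F x a"
      unfolding smooth_in_dir_def
    proof (intro allI impI)
      fix e :: real assume "e > 0"
      then obtain k where k: "1 / real (Suc k) < e"
        using nat_approx_posE by blast
      obtain t where t: "t > 0" "second_diff F x a t < 1 / real (Suc k) * t"
        using \<open>\<forall>k. x \<in> G k\<close> unfolding G_def by blast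
      then show "\<exists>t>0. second_diff F x a t < e * t"
        using k mult_strict_right_mono[OF k t(1)] by (intro exI[of _ t]) linarith
    qed
  next
    assume "smooth_in_dir F x a"
    moreover have "1 / real (Suc k) > 0" for k
      by simp
    ultimately show "\<forall>k. x \<in> G k"
      unfolding smooth_in_dir_def G_def by blast
  qed
  then have "{x. \<not> smooth_in_dir F x a} = (\<Union>k. - G k)"
    by auto
  moreover have "open (G k)" for k
    unfolding G_def using open_lt by blast
  ultimately show ?thesis by auto
qed

text \<open>
  The countable set \<open>C\<close> serves only to make the exceptional set Borel; the covering by line-null
  sets uses the given sequence of directions instead.
\<close>

theorem aronszajn_null_not_gateaux_differentiable:
  fixes F :: "'b::banach \<Rightarrow> real" and C U :: "'b set"
  assumes F: "convex_on UNIV F" and K: "K-lipschitz_on UNIV F"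
    and C: "countable C" "closure (span C) = UNIV"
    and U: "open U"
  shows "aronszajn_null {x \<in> U. \<not> gateaux_differentiable_at F x}"
proof -
  have cont: "continuous_on UNIV F"
    using K by (rule lipschitz_on_continuous_on)
  have borel: "U \<inter> {x. \<not> smooth_in_dir F x a} \<in> sets borel" for a
    using borel_nonsmooth[OF cont] U by (intro sets.Int) auto
  have null: "U \<inter> {x. \<not> smooth_in_dir F x a} \<in> line_null a" for a
  proof -
    have "countable {t::real. x + t *\<^sub>R a \<in> U \<inter> {x. \<not> smooth_in_dir F x a}}" for x
      by (rule countable_subset[OF _ countable_nonsmooth_on_line[OF F, of x a]]) auto
    then show ?thesis
      unfolding line_null_def using borel countable_imp_null_set_lborel by blast
  qed
  have eq: "{x \<in> U. \<not> gateaux_differentiable_at F x} = (\<Union>a\<in>D. U \<inter> {x. \<not> smooth_in_dir F x a})"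
    if "closure (span D) = UNIV" for D
    using gateaux_differentiable_iff_smooth_on[OF F K that] by auto
  have "{x \<in> U. \<not> gateaux_differentiable_at F x} \<in> sets borel"
    unfolding eq[OF C(2)] using C(1) borel by blast
  moreover have "{x \<in> U. \<not> gateaux_differentiable_at F x} \<in> seq_line_null a"
    if "closure (span (range a)) = UNIV" for a :: "nat \<Rightarrow> 'b"
    unfolding seq_line_null_def using calculation null eq[OF that]
    by (auto intro!: exI[of _ "\<lambda>n. U \<inter> {x. \<not> smooth_in_dir F x (a n)}"])
  ultimately show ?thesis
    unfolding aronszajn_null_def by blast
qed

section \<open>Pressure as a supremum over scales\<close>

lemma separated_mono:
  assumes "separated T n \<delta> E" "\<epsilon> \<le> \<delta>"
  shows "separated T n \<epsilon> E"
  using assms unfolding separated_def by (meson le_less_trans)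

lemma continuous_on_funpow:
  fixes T :: "'a::topological_space \<Rightarrow> 'a"
  assumes "continuous_on UNIV T"
  shows "continuous_on UNIV (T ^^ j)"
proof (induction j)
  case (Suc j)
  then show ?case
    using continuous_on_compose[OF Suc continuous_on_subset[OF assms]] by simp
qed (simp add: id_def)

text \<open>
  In the distance \<open>max\<^sub>j dist (T\<^sup>j x) (T\<^sup>j y)\<close>, whose balls are open, a separated set has
  at most one point in each ball of radius \<open>\<epsilon>/2\<close>, and finitely many such balls cover the space.
\<close>

lemma separated_card_bounded:
  fixes T :: "'a::metric_space \<Rightarrow> 'a"
  assumes X: "compact (UNIV :: 'a set)" and T: "continuous_on UNIV T" and "\<epsilon> > 0"
  obtains N where "\<And>E. separated T n \<epsilon> E \<Longrightarrow> finite E \<and> card E \<le> N"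
proof -
  define B where "B c = (\<Inter>j<n. {x. dist ((T ^^ j) c) ((T ^^ j) x) < \<epsilon> / 2})" for c
  have "open (B c)" for c
    unfolding B_def
    by (intro open_INT ballI open_Collect_less continuous_intros
        continuous_on_funpow[OF T]) auto
  moreover have "x \<in> B x" for x
    using \<open>\<epsilon> > 0\<close> by (simp add: B_def)
  ultimately obtain C where C: "finite C" "UNIV \<subseteq> (\<Union>c\<in>C. B c)"
    using compactE_image[OF X, of UNIV B] by (metis UNIV_I UN_I subsetI)
  then have "\<forall>x. \<exists>c\<in>C. x \<in> B c" by blast
  then obtain g where g: "g x \<in> C" "x \<in> B (g x)" for x by metis
  have "finite E \<and> card E \<le> card C" if E: "separated T n \<epsilon> E" for E
  proof -
    have "inj_on g E"
    proof (rule inj_onI, rule ccontr)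
      fix x y assume xy: "x \<in> E" "y \<in> E" "g x = g y" "x \<noteq> y"
      then obtain j where j: "j < n" "dist ((T ^^ j) x) ((T ^^ j) y) > \<epsilon>"
        using E unfolding separated_def by blast
      have "dist ((T ^^ j) (g x)) ((T ^^ j) x) < \<epsilon> / 2" "dist ((T ^^ j) (g x)) ((T ^^ j) y) < \<epsilon> / 2"
        using g[of x] g[of y] xy j by (auto simp: B_def)
      then show False
        using j dist_triangle3[of "(T ^^ j) x" "(T ^^ j) y" "(T ^^ j) (g x)"] by linarith
    qed
    moreover have "g ` E \<subseteq> C" using g by blast
    ultimately show ?thesis
      using C(1) by (auto intro: inj_on_finite card_inj_on_le)
  qed
  then show ?thesis by (rule that)
qed

definition orbit_sum :: "('a::metric_space \<Rightarrow> 'a) \<Rightarrow> ('a \<Rightarrow>\<^sub>C real) \<Rightarrow> nat \<Rightarrow> 'a \<Rightarrow> real" where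
  "orbit_sum T \<phi> n x = (\<Sum>i<n. apply_bcontfun \<phi> ((T ^^ i) x))"

lemma abs_orbit_sum_le: "\<bar>orbit_sum T \<phi> n x\<bar> \<le> n * norm \<phi>"
proof -
  have "\<bar>orbit_sum T \<phi> n x\<bar> \<le> (\<Sum>i<n. \<bar>apply_bcontfun \<phi> ((T ^^ i) x)\<bar>)"
    unfolding orbit_sum_def by (rule sum_abs)
  also have "\<dots> \<le> (\<Sum>i<n. norm \<phi>)"
    by (rule sum_mono) (use norm_bounded[of \<phi>] in simp)
  finally show ?thesis by simp
qed

lemma orbit_sum_add: "orbit_sum T (\<phi> + \<psi>) n x = orbit_sum T \<phi> n x + orbit_sum T \<psi> n x"
  by (simp add: orbit_sum_def plus_bcontfun.rep_eq sum.distrib)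

lemma orbit_sum_scaleR: "orbit_sum T (c *\<^sub>R \<phi>) n x = c * orbit_sum T \<phi> n x"
  by (simp add: orbit_sum_def scaleR_bcontfun.rep_eq sum_distrib_left)

locale compact_dynamics =
  fixes T :: "'a::metric_space \<Rightarrow> 'a"
  assumes compact_space: "compact (UNIV :: 'a set)" and continuous_map: "continuous_on UNIV T"
begin

lemma sum_le_sep_sum_sup:
  assumes "\<epsilon> > 0" and E: "separated T n \<epsilon> E"
  shows "(\<Sum>x\<in>E. exp (orbit_sum T \<phi> n x)) \<le> sep_sum_sup T \<phi> \<epsilon> n"
proof -
  obtain N where N: "\<And>E. separated T n \<epsilon> E \<Longrightarrow> finite E \<and> card E \<le> N"
    using separated_card_bounded[OF compact_space continuous_map \<open>\<epsilon> > 0\<close>] by blast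
  have "(\<Sum>x\<in>E. exp (orbit_sum T \<phi> n x)) \<le> N * exp (n * norm \<phi>)" if "separated T n \<epsilon> E" for E
  proof -
    have "exp (orbit_sum T \<phi> n x) \<le> exp (n * norm \<phi>)" for x
      using abs_orbit_sum_le[of T \<phi> n x] by simp
    then have "(\<Sum>x\<in>E. exp (orbit_sum T \<phi> n x)) \<le> card E * exp (n * norm \<phi>)"
      by (intro sum_bounded_above) auto
    also have "\<dots> \<le> N * exp (n * norm \<phi>)"
      using N[OF that] by (intro mult_right_mono) auto
    finally show ?thesis .
  qed
  then have "bdd_above {\<Sum>x\<in>E. exp (orbit_sum T \<phi> n x) | E. separated T n \<epsilon> E}"
    by (intro bdd_aboveI) blast
  then show ?thesis
    unfolding sep_sum_sup_def orbit_sum_def[symmetric] using E by (intro cSup_upper) auto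
qed

lemma sep_sum_sup_least:
  assumes "\<And>E. separated T n \<epsilon> E \<Longrightarrow> (\<Sum>x\<in>E. exp (orbit_sum T \<phi> n x)) \<le> c"
  shows "sep_sum_sup T \<phi> \<epsilon> n \<le> c"
proof -
  have "separated T n \<epsilon> {}" by (simp add: separated_def)
  then have "{\<Sum>x\<in>E. exp (orbit_sum T \<phi> n x) | E. separated T n \<epsilon> E} \<noteq> {}"
    by blast
  then show ?thesis
    unfolding sep_sum_sup_def orbit_sum_def[symmetric] by (rule cSup_least) (use assms in blast)
qed

text \<open>A single point is a separated set.\<close>

lemma exp_le_sep_sum_sup:
  assumes "\<epsilon> > 0"
  shows "exp (- (n * norm \<phi>)) \<le> sep_sum_sup T \<phi> \<epsilon> n"
proof -
  have "exp (orbit_sum T \<phi> n x) \<le> sep_sum_sup T \<phi> \<epsilon> n" for x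
    using sum_le_sep_sum_sup[OF assms, of n "{x}"] by (simp add: separated_def)
  moreover have "exp (- (n * norm \<phi>)) \<le> exp (orbit_sum T \<phi> n x)" for x
    using abs_orbit_sum_le[of T \<phi> n x] by simp
  ultimately show ?thesis using order_trans by blast
qed

corollary sep_sum_sup_pos: "\<epsilon> > 0 \<Longrightarrow> 0 < sep_sum_sup T \<phi> \<epsilon> n"
  by (rule less_le_trans[OF exp_gt_zero exp_le_sep_sum_sup])

definition growth_rate :: "('a \<Rightarrow>\<^sub>C real) \<Rightarrow> real \<Rightarrow> nat \<Rightarrow> real" where
  "growth_rate \<phi> \<epsilon> n = 1 / real n * ln (sep_sum_sup T \<phi> \<epsilon> n)"

lemma growth_rate_antimono:
  assumes "0 < \<epsilon>" "\<epsilon> \<le> \<delta>"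
  shows "growth_rate \<phi> \<delta> n \<le> growth_rate \<phi> \<epsilon> n"
proof -
  have "sep_sum_sup T \<phi> \<delta> n \<le> sep_sum_sup T \<phi> \<epsilon> n"
    by (rule sep_sum_sup_least, rule sum_le_sep_sum_sup[OF assms(1)], erule separated_mono[OF _ assms(2)])
  then have "ln (sep_sum_sup T \<phi> \<delta> n) \<le> ln (sep_sum_sup T \<phi> \<epsilon> n)"
    using sep_sum_sup_pos[of \<delta>] assms by (intro ln_mono) auto
  then show ?thesis
    unfolding growth_rate_def by (intro mult_left_mono) auto
qed

text \<open>A finer scale allows more separated sets, so the limit in \<open>\<epsilon>\<close> is monotone.\<close>

lemma pressure_eq_SUP:
  "pressure T \<phi> = (SUP \<epsilon>\<in>{0<..}. limsup (\<lambda>n. ereal (growth_rate \<phi> \<epsilon> n)))"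
proof -
  define f where "f \<epsilon> = limsup (\<lambda>n. ereal (growth_rate \<phi> \<epsilon> n))" for \<epsilon>
  define S where "S = (SUP \<epsilon>\<in>{0<..}. f \<epsilon>)"
  have anti: "f \<delta> \<le> f \<epsilon>" if "0 < \<epsilon>" "\<epsilon> \<le> \<delta>" for \<epsilon> \<delta>
    unfolding f_def using growth_rate_antimono[OF that] by (intro Limsup_mono) auto
  have "(f \<longlongrightarrow> S) (at_right 0)"
  proof (rule order_tendstoI)
    fix c assume "c < S"
    then obtain \<delta> where \<delta>: "\<delta> > 0" "c < f \<delta>"
      unfolding S_def less_SUP_iff by auto
    then have "\<forall>\<epsilon>>0. \<epsilon> < \<delta> \<longrightarrow> c < f \<epsilon>"
      using anti by (meson less_imp_le less_le_trans)
    then show "\<forall>\<^sub>F \<epsilon> in at_right 0. c < f \<epsilon>"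
      unfolding eventually_at_right_field using \<delta>(1) by blast
  next
    fix c assume "S < c"
    then have "\<forall>\<epsilon>>0. f \<epsilon> < c"
      unfolding S_def by (meson SUP_upper greaterThan_iff le_less_trans)
    then show "\<forall>\<^sub>F \<epsilon> in at_right 0. f \<epsilon> < c"
      unfolding eventually_at_right_field by (intro exI[of _ 1]) auto
  qed
  then have "Lim (at_right 0) f = S"
    by (intro tendsto_Lim) auto
  then show ?thesis
    unfolding pressure_def S_def f_def growth_rate_def .
qed

text \<open>
  The next two lemmas characterise the real numbers above the pressure by eventual bounds on the
  growth rates. Any inequality between growth rates at fixed \<open>n\<close> and \<open>\<epsilon>\<close> thereby passes to the
  pressure, without arithmetic of upper limits in the extended reals.
\<close>

lemma eventually_growth_rate_less:
  assumes "pressure T \<phi> < ereal c" "\<epsilon> > 0"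
  shows "\<forall>\<^sub>F n in sequentially. growth_rate \<phi> \<epsilon> n < c"
proof -
  have "limsup (\<lambda>n. ereal (growth_rate \<phi> \<epsilon> n)) \<le> pressure T \<phi>"
    unfolding pressure_eq_SUP using assms(2) by (intro SUP_upper) auto
  then show ?thesis
    using Limsup_lessD[of sequentially "\<lambda>n. ereal (growth_rate \<phi> \<epsilon> n)" "ereal c"] assms(1)
    by auto
qed

lemma pressure_le:
  assumes "\<And>\<epsilon>. \<epsilon> > 0 \<Longrightarrow> \<forall>\<^sub>F n in sequentially. growth_rate \<phi> \<epsilon> n \<le> c"
  shows "pressure T \<phi> \<le> ereal c"
  unfolding pressure_eq_SUP using assms by (intro SUP_least Limsup_bounded) auto

lemma pressure_ge: "ereal (- norm \<phi>) \<le> pressure T \<phi>"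
proof -
  have "- norm \<phi> \<le> growth_rate \<phi> 1 n" for n
  proof (cases "n = 0")
    case False
    have "- (n * norm \<phi>) \<le> ln (sep_sum_sup T \<phi> 1 n)"
      using exp_le_sep_sum_sup[of 1 n \<phi>] sep_sum_sup_pos[of 1 \<phi> n] by (simp add: ln_ge_iff)
    then have "1 / real n * - (n * norm \<phi>) \<le> growth_rate \<phi> 1 n"
      unfolding growth_rate_def by (intro mult_left_mono) auto
    then show ?thesis using False by simp
  qed (simp add: growth_rate_def)
  then have "ereal (- norm \<phi>) \<le> limsup (\<lambda>n. ereal (growth_rate \<phi> 1 n))"
    by (intro le_Limsup) auto
  also have "\<dots> \<le> pressure T \<phi>"
    unfolding pressure_eq_SUP by (intro SUP_upper) auto
  finally show ?thesis .
qed

section \<open>Convexity and Lipschitz continuity of the pressure\<close>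

lemma growth_rate_le_dist:
  assumes "\<epsilon> > 0"
  shows "growth_rate \<psi> \<epsilon> n \<le> growth_rate \<phi> \<epsilon> n + dist \<phi> \<psi>"
proof (cases "n = 0")
  case False
  let ?Q = "sep_sum_sup T \<phi> \<epsilon> n"
  have "sep_sum_sup T \<psi> \<epsilon> n \<le> exp (n * dist \<phi> \<psi>) * ?Q"
  proof (rule sep_sum_sup_least)
    fix E assume E: "separated T n \<epsilon> E"
    have "orbit_sum T \<psi> n x \<le> n * dist \<phi> \<psi> + orbit_sum T \<phi> n x" for x
      using abs_orbit_sum_le[of T "\<psi> - \<phi>" n x] orbit_sum_add[of T "\<psi> - \<phi>" \<phi> n x]
      by (simp add: dist_norm norm_minus_commute)
    then have "(\<Sum>x\<in>E. exp (orbit_sum T \<psi> n x))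
        \<le> (\<Sum>x\<in>E. exp (n * dist \<phi> \<psi>) * exp (orbit_sum T \<phi> n x))"
      by (intro sum_mono) (simp flip: exp_add)
    also have "\<dots> \<le> exp (n * dist \<phi> \<psi>) * ?Q"
      using sum_le_sep_sum_sup[OF assms E] by (simp flip: sum_distrib_left)
    finally show "(\<Sum>x\<in>E. exp (orbit_sum T \<psi> n x)) \<le> exp (n * dist \<phi> \<psi>) * ?Q" .
  qed
  then have "ln (sep_sum_sup T \<psi> \<epsilon> n) \<le> ln (exp (n * dist \<phi> \<psi>) * ?Q)"
    using sep_sum_sup_pos[OF assms] by (intro ln_mono) auto
  also have "\<dots> = n * dist \<phi> \<psi> + ln ?Q"
    using sep_sum_sup_pos[OF assms, of \<phi> n] by (simp add: ln_mult)
  finally have "growth_rate \<psi> \<epsilon> n \<le> 1 / real n * (n * dist \<phi> \<psi> + ln ?Q)"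
    unfolding growth_rate_def by (intro mult_left_mono) auto
  also have "\<dots> = growth_rate \<phi> \<epsilon> n + dist \<phi> \<psi>"
    using False by (simp add: growth_rate_def distrib_left)
  finally show ?thesis .
qed (simp add: growth_rate_def)

text \<open>
  Hoelder's inequality. After normalising by the suprema \<open>A\<close>, \<open>B\<close> for \<open>\<phi>\<close>, \<open>\<psi>\<close>, convexity of \<open>exp\<close>
  bounds the sum for the convex combination by the convex combination of two sums that are at
  most \<open>1\<close>.
\<close>

lemma growth_rate_convex:
  assumes "\<epsilon> > 0" and u: "0 \<le> u" "u \<le> 1"
  shows "growth_rate ((1 - u) *\<^sub>R \<phi> + u *\<^sub>R \<psi>) \<epsilon> n
    \<le> (1 - u) * growth_rate \<phi> \<epsilon> n + u * growth_rate \<psi> \<epsilon> n"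
proof -
  define A where "A = sep_sum_sup T \<phi> \<epsilon> n"
  define B where "B = sep_sum_sup T \<psi> \<epsilon> n"
  define c where "c = (1 - u) * ln A + u * ln B"
  let ?\<chi> = "(1 - u) *\<^sub>R \<phi> + u *\<^sub>R \<psi>"
  have AB: "A > 0" "B > 0"
    using sep_sum_sup_pos[OF assms(1)] by (auto simp: A_def B_def)
  have "sep_sum_sup T ?\<chi> \<epsilon> n \<le> exp c"
  proof (rule sep_sum_sup_least)
    fix E assume E: "separated T n \<epsilon> E"
    have "exp (orbit_sum T ?\<chi> n x)
      \<le> exp c * ((1 - u) * (exp (orbit_sum T \<phi> n x) / A) + u * (exp (orbit_sum T \<psi> n x) / B))" for x
    proof -
      have "orbit_sum T ?\<chi> n x
          = c + ((1 - u) *\<^sub>R (orbit_sum T \<phi> n x - ln A) + u *\<^sub>R (orbit_sum T \<psi> n x - ln B))"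
        unfolding orbit_sum_add orbit_sum_scaleR c_def by (simp add: algebra_simps)
      then have "exp (orbit_sum T ?\<chi> n x)
          = exp c * exp ((1 - u) *\<^sub>R (orbit_sum T \<phi> n x - ln A) + u *\<^sub>R (orbit_sum T \<psi> n x - ln B))"
        by (simp only: exp_add)
      also have "exp ((1 - u) *\<^sub>R (orbit_sum T \<phi> n x - ln A) + u *\<^sub>R (orbit_sum T \<psi> n x - ln B))
          \<le> (1 - u) * exp (orbit_sum T \<phi> n x - ln A) + u * exp (orbit_sum T \<psi> n x - ln B)"
        by (rule convex_onD[OF exp_convex u]) auto
      finally show ?thesis
        using AB by (simp add: exp_diff)
    qed
    then have "(\<Sum>x\<in>E. exp (orbit_sum T ?\<chi> n x))
      \<le> (\<Sum>x\<in>E. exp c * ((1 - u) * (exp (orbit_sum T \<phi> n x) / A) + u * (exp (orbit_sum T \<psi> n x) / B)))"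
      by (intro sum_mono)
    also have "\<dots> = exp c * ((1 - u) * ((\<Sum>x\<in>E. exp (orbit_sum T \<phi> n x)) / A)
        + u * ((\<Sum>x\<in>E. exp (orbit_sum T \<psi> n x)) / B))"
      by (simp add: sum.distrib flip: sum_distrib_left sum_divide_distrib)
    also have "\<dots> \<le> exp c * ((1 - u) * 1 + u * 1)"
      using sum_le_sep_sum_sup[OF assms(1) E] AB u
      by (intro mult_left_mono add_mono) (auto simp: A_def B_def)
    finally show "(\<Sum>x\<in>E. exp (orbit_sum T ?\<chi> n x)) \<le> exp c" by simp
  qed
  then have "ln (sep_sum_sup T ?\<chi> \<epsilon> n) \<le> c"
    using sep_sum_sup_pos[OF assms(1), of ?\<chi> n] by (metis ln_exp ln_mono)
  then have "growth_rate ?\<chi> \<epsilon> n \<le> 1 / real n * c"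
    unfolding growth_rate_def by (intro mult_left_mono) auto
  then show ?thesis
    by (simp add: growth_rate_def c_def A_def B_def distrib_left mult.left_commute)
qed

context
  assumes finite_entropy: "top_entropy T < \<infinity>"
begin

lemma pressure_finite: "ereal (real_of_ereal (pressure T \<phi>)) = pressure T \<phi>"
proof -
  obtain h where h: "pressure T 0 < ereal h"
    using ereal_dense2[OF finite_entropy] unfolding top_entropy_def by blast
  have "pressure T \<phi> \<le> ereal (h + dist 0 \<phi>)"
  proof (rule pressure_le)
    fix \<epsilon> :: real assume "\<epsilon> > 0"
    show "\<forall>\<^sub>F n in sequentially. growth_rate \<phi> \<epsilon> n \<le> h + dist 0 \<phi>"
      using eventually_growth_rate_less[OF h \<open>\<epsilon> > 0\<close>]
    proof eventually_elim
      case (elim n)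
      then show ?case using growth_rate_le_dist[OF \<open>\<epsilon> > 0\<close>, of \<phi> n 0] by linarith
    qed
  qed
  then show ?thesis
    using pressure_ge[of \<phi>] by (intro ereal_real') auto
qed

abbreviation real_pressure :: "('a \<Rightarrow>\<^sub>C real) \<Rightarrow> real" where
  "real_pressure \<phi> \<equiv> real_of_ereal (pressure T \<phi>)"

lemma real_pressure_le:
  assumes "\<And>\<epsilon>. \<epsilon> > 0 \<Longrightarrow> \<forall>\<^sub>F n in sequentially. growth_rate \<phi> \<epsilon> n \<le> c"
  shows "real_pressure \<phi> \<le> c"
  using pressure_le[OF assms] pressure_finite[of \<phi>] by (metis ereal_less_eq(3))

lemma eventually_growth_rate_less_real:
  assumes "real_pressure \<phi> < c" "\<epsilon> > 0"
  shows "\<forall>\<^sub>F n in sequentially. growth_rate \<phi> \<epsilon> n < c"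
  using eventually_growth_rate_less assms pressure_finite[of \<phi>] by (metis less_ereal.simps(1))

lemma lipschitz_pressure: "1-lipschitz_on UNIV real_pressure"
proof (rule lipschitz_onI)
  have le: "real_pressure \<psi> \<le> real_pressure \<phi> + dist \<phi> \<psi>" for \<phi> \<psi>
  proof (rule field_le_epsilon)
    fix e :: real assume "e > 0"
    then have *: "real_pressure \<phi> < real_pressure \<phi> + e" by simp
    show "real_pressure \<psi> \<le> real_pressure \<phi> + dist \<phi> \<psi> + e"
    proof (rule real_pressure_le)
      fix \<epsilon> :: real assume "\<epsilon> > 0"
      show "\<forall>\<^sub>F n in sequentially. growth_rate \<psi> \<epsilon> n \<le> real_pressure \<phi> + dist \<phi> \<psi> + e"
        using eventually_growth_rate_less_real[OF * \<open>\<epsilon> > 0\<close>]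
      proof eventually_elim
        case (elim n)
        then show ?case using growth_rate_le_dist[OF \<open>\<epsilon> > 0\<close>, of \<psi> n \<phi>] by linarith
      qed
    qed
  qed
  show "dist (real_pressure \<phi>) (real_pressure \<psi>) \<le> 1 * dist \<phi> \<psi>" for \<phi> \<psi>
    using le[of \<phi> \<psi>] le[of \<psi> \<phi>] by (simp add: dist_real_def dist_commute abs_le_iff)
qed simp

lemma convex_pressure: "convex_on UNIV real_pressure"
proof (rule convex_onI)
  fix u :: real and \<phi> \<psi> :: "'a \<Rightarrow>\<^sub>C real"
  assume u: "0 < u" "u < 1"
  show "real_pressure ((1 - u) *\<^sub>R \<phi> + u *\<^sub>R \<psi>) \<le> (1 - u) * real_pressure \<phi> + u * real_pressure \<psi>"
  proof (rule field_le_epsilon)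
    fix e :: real assume "e > 0"
    then have *: "real_pressure \<phi> < real_pressure \<phi> + e" "real_pressure \<psi> < real_pressure \<psi> + e"
      by auto
    show "real_pressure ((1 - u) *\<^sub>R \<phi> + u *\<^sub>R \<psi>)
      \<le> (1 - u) * real_pressure \<phi> + u * real_pressure \<psi> + e"
    proof (rule real_pressure_le)
      fix \<epsilon> :: real assume \<epsilon>: "\<epsilon> > 0"
      show "\<forall>\<^sub>F n in sequentially. growth_rate ((1 - u) *\<^sub>R \<phi> + u *\<^sub>R \<psi>) \<epsilon> n
        \<le> (1 - u) * real_pressure \<phi> + u * real_pressure \<psi> + e"
        using eventually_growth_rate_less_real[OF *(1) \<epsilon>] eventually_growth_rate_less_real[OF *(2) \<epsilon>]
      proof eventually_elim
        case (elim n)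
        have "growth_rate ((1 - u) *\<^sub>R \<phi> + u *\<^sub>R \<psi>) \<epsilon> n
            \<le> (1 - u) * growth_rate \<phi> \<epsilon> n + u * growth_rate \<psi> \<epsilon> n"
          using u by (intro growth_rate_convex[OF \<epsilon>]) auto
        also have "\<dots> \<le> (1 - u) * (real_pressure \<phi> + e) + u * (real_pressure \<psi> + e)"
          using u elim by (intro add_mono mult_left_mono) auto
        finally show ?case by (simp add: algebra_simps)
      qed
    qed
  qed
qed simp

end

end

section \<open>A countable set with dense span in the space of continuous functions\<close>

text \<open>
  Take the partitions of unity subordinate to finite covers by balls of radius \<open>1/(k+1)\<close>. By uniform
  continuity, interpolating a function at the centres of the balls approximates it uniformly: only
  the centres within \<open>1/(k+1)\<close> of \<open>x\<close> contribute to the interpolant at \<open>x\<close>.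
\<close>

lemma countable_dense_span_bcontfun:
  assumes X: "compact (UNIV :: 'a set)"
  obtains C :: "('a::metric_space \<Rightarrow>\<^sub>C real) set" where "countable C" "closure (span C) = UNIV"
proof -
  define r where "r k = 1 / real (Suc k)" for k
  have r: "r k > 0" for k by (simp add: r_def)
  have "\<forall>k. \<exists>D. finite D \<and> (UNIV :: 'a set) \<subseteq> (\<Union>c\<in>D. ball c (r k))"
  proof
    fix k
    obtain D where "finite D" "(UNIV :: 'a set) \<subseteq> (\<Union>c\<in>D. ball c (r k))"
      using compactE_image[OF X, of UNIV "\<lambda>c. ball c (r k)"] r
      by (metis UN_I UNIV_I centre_in_ball open_ball subsetI)
    then show "\<exists>D. finite D \<and> (UNIV :: 'a set) \<subseteq> (\<Union>c\<in>D. ball c (r k))" by blast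
  qed
  then obtain D where D: "\<And>k. finite (D k)" "\<And>k. (UNIV :: 'a set) \<subseteq> (\<Union>c\<in>D k. ball c (r k))"
    by metis
  define h where "h k c x = max 0 (r k - dist c x)" for k and c x :: 'a
  define s where "s k x = (\<Sum>c\<in>D k. h k c x)" for k x
  have h_nonneg: "h k c x \<ge> 0" for k c x by (simp add: h_def)
  have s_pos: "s k x > 0" for k x
  proof -
    obtain c where "c \<in> D k" "dist c x < r k"
      using D(2)[of k] by (metis UNIV_I UN_E mem_ball subsetD)
    then show ?thesis
      unfolding s_def using D(1) h_nonneg by (intro sum_pos2[of _ c]) (auto simp: h_def)
  qed
  have bcont: "(\<lambda>x. h k c x / s k x) \<in> bcontfun" for k c
  proof -
    have "continuous_on UNIV (\<lambda>x. h k c x / s k x)"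
      using s_pos[of k] unfolding h_def s_def
      by (intro continuous_intros ballI) (auto simp: less_le)
    moreover have "bounded (range (\<lambda>x. h k c x / s k x))"
      using calculation X by (intro compact_imp_bounded compact_continuous_image)
    ultimately show ?thesis unfolding bcontfun_def by blast
  qed
  define p where "p k c = Bcontfun (\<lambda>x. h k c x / s k x)" for k c
  have p: "apply_bcontfun (p k c) x = h k c x / s k x" for k c x
    unfolding p_def using bcont by (simp add: Bcontfun_inverse)
  define C where "C = (\<Union>k. p k ` D k)"
  have "countable C"
    unfolding C_def using D(1) by (intro countable_UN countable_image) (auto intro: countable_finite)
  moreover have "f \<in> closure (span C)" for f :: "'a \<Rightarrow>\<^sub>C real"
    unfolding closure_approachable
  proof (intro allI impI)
    fix e :: real assume "e > 0"
    then have "e / 2 > 0" by simp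
    have "uniformly_continuous_on UNIV (apply_bcontfun f)"
      using X by (intro compact_uniformly_continuous) auto
    then obtain d where d: "d > 0" "\<And>x y. dist x y < d \<Longrightarrow> dist (f x) (f y) < e / 2"
      using \<open>e / 2 > 0\<close> unfolding uniformly_continuous_on_def by (metis UNIV_I)
    obtain k where k: "r k < d"
      using d(1) nat_approx_posE unfolding r_def by blast
    define g where "g = (\<Sum>c\<in>D k. f c *\<^sub>R p k c)"
    have "g \<in> span C"
      unfolding g_def C_def by (intro span_sum span_scale span_base) auto
    have g: "apply_bcontfun g x = (\<Sum>c\<in>D k. f c * (h k c x / s k x))" for x
    proof -
      have "apply_bcontfun (\<Sum>c\<in>A. f c *\<^sub>R p k c) x = (\<Sum>c\<in>A. f c * (h k c x / s k x))" for A
        by (induction A rule: infinite_finite_induct)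
          (auto simp: zero_bcontfun.rep_eq plus_bcontfun.rep_eq scaleR_bcontfun.rep_eq p)
      then show ?thesis by (simp add: g_def)
    qed
    have "dist g f \<le> e / 2"
    proof (rule dist_bound)
      fix x
      have one: "(\<Sum>c\<in>D k. h k c x / s k x) = 1"
        using s_pos[of k x] by (simp add: s_def flip: sum_divide_distrib)
      have "g x - f x = (\<Sum>c\<in>D k. f c * (h k c x / s k x)) - f x * (\<Sum>c\<in>D k. h k c x / s k x)"
        by (simp only: g one mult_1_right)
      also have "\<dots> = (\<Sum>c\<in>D k. (f c - f x) * (h k c x / s k x))"
        by (simp only: sum_distrib_left left_diff_distrib sum_subtractf)
      finally have "\<bar>g x - f x\<bar> \<le> (\<Sum>c\<in>D k. \<bar>(f c - f x) * (h k c x / s k x)\<bar>)"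
        by (simp only: sum_abs)
      also have "\<dots> \<le> (\<Sum>c\<in>D k. e / 2 * (h k c x / s k x))"
      proof (rule sum_mono)
        fix c
        show "\<bar>(f c - f x) * (h k c x / s k x)\<bar> \<le> e / 2 * (h k c x / s k x)"
        proof (cases "dist c x < r k")
          case True
          then have "\<bar>f c - f x\<bar> \<le> e / 2"
            using d(2)[of c x] k by (simp add: dist_real_def)
          moreover have "0 \<le> h k c x / s k x"
            using h_nonneg s_pos[of k x] by simp
          ultimately show ?thesis
            by (simp only: abs_mult abs_of_nonneg mult_right_mono)
        next
          case False
          then have "h k c x = 0" by (simp add: h_def)
          then show ?thesis by simp
        qed
      qed
      also have "\<dots> = e / 2"
        unfolding sum_distrib_left[symmetric] one by simp
      finally show "dist (g x) (f x) \<le> e / 2" by (simp add: dist_real_def)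
    qed
    then show "\<exists>g\<in>span C. dist g f < e"
      using \<open>g \<in> span C\<close> \<open>e > 0\<close> by (intro bexI[of _ g]) auto
  qed
  ultimately show ?thesis
    using that by blast
qed

theorem proposition2p11:
  fixes T :: "'a::metric_space \<Rightarrow> 'a"
    and U :: "('a \<Rightarrow>\<^sub>C real) set"
  assumes "compact (UNIV :: 'a set)"
    and "continuous_on UNIV T"
    and "top_entropy T < \<infinity>"
    and "open U"
  shows "aronszajn_null
    {\<phi> \<in> U. \<not> gateaux_differentiable_at (\<lambda>\<psi>. real_of_ereal (pressure T \<psi>)) \<phi>}"
proof -
  interpret compact_dynamics T
    using assms(1,2) by unfold_locales
  obtain C :: "('a \<Rightarrow>\<^sub>C real) set" where C: "countable C" "closure (span C) = UNIV"
    using countable_dense_span_bcontfun[OF assms(1)] by blast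
  show ?thesis
    using aronszajn_null_not_gateaux_differentiable[OF convex_pressure[OF assms(3)]
        lipschitz_pressure[OF assms(3)] C assms(4)] .
qed

end
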